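(* Let $Q=(Q_0,Q_1)$ be a quiver (finite, without loops and multiple edges). Then \[ \dim(\operatorname{DE}(Q))=\begin{cases} \#Q_0-\#\pi_0(Q)-1 & \text{if } Q \text{ has a rank function},\\ \#Q_0-\#\pi_0(Q) & \text{otherwise.}\end{cases} \]
   Context: A quiver is a pair $Q=(Q_0,Q_1)$ with $Q_0$ a finite set and $Q_1\subset (Q_0\times Q_0)\setminus\{(v,v)\mid v\in Q_0\}$; elements $(v,w)\in Q_1$ are edges from $v$ to $w$. For $v\in Q_0$ let $\kappa_{\{v\}}\in\mathbb{R}^{Q_0}$ be the indicator function of $v$ (the standard basis of the space $\mathbb{R}^{Q_0}$ of functions $Q_0\to\mathbb{R}$), and $\varepsilon_{(v,w)}=\kappa_{\{v\}}-\kappa_{\{w\}}$. The directed edge polytope is $\operatorname{DE}(Q)=\operatorname{conv}\{\varepsilon_{(v,w)}\mid (v,w)\in Q_1\}\subset\mathbb{R}^{Q_0}$ (the empty polytope has dimension $-1$). An undirected walk is a sequence $(v_0,\dots,v_n)$ of vertices with $(v_t,v_{t+1})\in Q_1$ or $(v_{t+1},v_t)\in Q_1$ for all $t$; $Q$ is connected if any two vertices are joined by an undirected walk, and $\pi_0(Q)$ is the set of connected components (maximal connected subquivers). A rank function of $Q$ is a function $\rho:Q_0\to\mathbb{R}$ with $\rho(v)+1=\rho(w)$ for every edge $(v,w)\in Q_1$. *)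

theory Defs
  imports "HOL-Analysis.Analysis" "Graph_Theory.Digraph_Component"
begin

text \<open>
  A quiver is a \<^locale>\<open>pair_digraph\<close>: a finite set of vertices together with a set of ordered
  pairs of distinct vertices. The vertex set \<^term>\<open>pverts Q\<close> is an arbitrary, possibly empty,
  subset of a finite type \<open>'v\<close>, and the space of functions \<open>pverts Q \<rightarrow> \<real>\<close> is realized as the
  subspace of \<open>real ^ 'v\<close> consisting of the vectors supported on \<^term>\<open>pverts Q\<close>.
\<close>

definition vertex_indicator :: "'v::finite set \<Rightarrow> real ^ 'v" where
  "vertex_indicator S = (\<chi> u. indicat_real S u)"

definition edge_vector :: "'v \<times> 'v \<Rightarrow> real ^ 'v::finite" where
  "edge_vector e = vertex_indicator {fst e} - vertex_indicator {snd e}"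

definition directed_edge_polytope :: "'v::finite pair_pre_digraph \<Rightarrow> (real ^ 'v) set" where
  "directed_edge_polytope Q = convex hull (edge_vector ` parcs Q)"

text \<open>
  The constant \<^const>\<open>Digraph_Component.connected\<close> is connectedness by undirected walks. It requires
  at least one vertex, so the empty quiver has no connected component.
\<close>

definition connected_components ::
    "'v pair_pre_digraph \<Rightarrow> ('v, 'v \<times> 'v) pre_digraph set" where
  "connected_components Q =
    {H. pre_digraph.max_subgraph (with_proj Q) Digraph_Component.connected H}"

text \<open>
  A rank function is only constrained on edges, so its values outside \<^term>\<open>pverts Q\<close> are irrelevant.
\<close>

definition rank_function :: "'v pair_pre_digraph \<Rightarrow> ('v \<Rightarrow> real) \<Rightarrow> bool" where
  "rank_function Q \<rho> \<longleftrightarrow> (\<forall>(v, w) \<in> parcs Q. \<rho> v + 1 = \<rho> w)"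

end

theory Submission
  imports Defs
begin

text \<open>
  A vector is orthogonal to all edge vectors iff it is constant on connected components, so
  inside the space of vectors supported on the vertices, the indicators of the components form
  an orthogonal basis of the complement of the span of the edge vectors. This gives the linear
  dimension of the edge vectors as the number of vertices minus the number of components. The
  affine dimension is smaller by one exactly if \<open>0\<close> is not in the affine hull, that is, if some
  linear functional takes the value \<open>1\<close> on all edge vectors; the negatives of such functionals are rank functions.
\<close>

section \<open>Connected components\<close>

text \<open>Components are treated as vertex sets, with undirected walks encoded as reachability in
  the symmetrized graph. The maximal connected subgraphs are recovered as the subgraphs induced on
  these sets in \<open>max_subgraph_connected_eq\<close>.\<close>

definition component_of :: "('a, 'b) pre_digraph \<Rightarrow> 'a \<Rightarrow> 'a set" where
  "component_of G u = {v. u \<rightarrow>\<^sup>*\<^bsub>mk_symmetric G\<^esub> v}"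

context wf_digraph
begin

interpretation S: pair_wf_digraph "mk_symmetric G"
  by (rule wellformed_mk_symmetric)

lemma component_of_subset: "component_of G u \<subseteq> verts G"
  unfolding component_of_def using S.reachable_in_verts(2) by auto

lemma component_of_refl: "u \<in> verts G \<Longrightarrow> u \<in> component_of G u"
  unfolding component_of_def by simp

lemma component_of_eq:
  assumes "v \<in> component_of G u"
  shows "component_of G v = component_of G u"
proof -
  have uv: "u \<rightarrow>\<^sup>*\<^bsub>mk_symmetric G\<^esub> v"
    using assms by (simp add: component_of_def)
  then have vu: "v \<rightarrow>\<^sup>*\<^bsub>mk_symmetric G\<^esub> u"
    by (rule symmetric_reachable[OF symmetric_mk_symmetric])
  show ?thesis
    unfolding component_of_def using uv vu S.reachable_trans by blast
qed

lemma component_of_arc: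
  assumes "e \<in> arcs G"
  shows "component_of G (head G e) = component_of G (tail G e)"
proof (rule component_of_eq)
  have "(tail G e, head G e) \<in> parcs (mk_symmetric G)"
    using assms by (auto simp: parcs_mk_symmetric)
  then show "head G e \<in> component_of G (tail G e)"
    unfolding component_of_def using S.reachable_adjI by simp
qed

lemma disjoint_component_of:
  assumes "A \<in> component_of G ` verts G" "B \<in> component_of G ` verts G" "A \<noteq> B"
  shows "A \<inter> B = {}"
  using assms component_of_eq by blast

lemma mk_symmetric_induce:
  "with_proj (mk_symmetric (G \<restriction> component_of G u))
    = with_proj (mk_symmetric G) \<restriction> component_of G u"
  unfolding mk_symmetric_def with_proj_def induce_subgraph_def by auto

lemma connected_induce_component_of:
  assumes "u \<in> verts G"
  shows "Digraph_Component.connected (G \<restriction> component_of G u)"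
  unfolding connected_def mk_symmetric_induce
proof (rule strongly_connectedI)
  show "verts (with_proj (mk_symmetric G) \<restriction> component_of G u) \<noteq> {}"
    using component_of_refl[OF assms] by auto
next
  fix v w
  assume v: "v \<in> verts (with_proj (mk_symmetric G) \<restriction> component_of G u)"
    and w: "w \<in> verts (with_proj (mk_symmetric G) \<restriction> component_of G u)"
  have eq: "component_of G v = component_of G u"
    using v by (intro component_of_eq) simp
  have "v \<rightarrow>\<^sup>*\<^bsub>mk_symmetric G\<^esub> w"
    using w eq by (auto simp: component_of_def)
  \<comment> \<open>A walk stays among the vertices reachable from its start \<open>v\<close>, so it
    survives in the subgraph induced on them; by \<open>eq\<close> this set is the component of
    \<open>u\<close>.\<close>
  from S.induce_reachable_preserves_paths[OF this]
  show "v \<rightarrow>\<^sup>*\<^bsub>with_proj (mk_symmetric G) \<restriction> component_of G u\<^esub> w"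
    using eq by (simp add: component_of_def)
qed

lemma connected_subgraph_verts_subset:
  assumes "subgraph H G" "Digraph_Component.connected H" "u \<in> verts H"
  shows "verts H \<subseteq> component_of G u"
proof
  fix v assume "v \<in> verts H"
  then have "u \<rightarrow>\<^sup>*\<^bsub>mk_symmetric H\<^esub> v"
    using assms by (auto simp: connected_def strongly_connected_def)
  then have "u \<rightarrow>\<^sup>*\<^bsub>mk_symmetric G\<^esub> v"
    using subgraph_mk_symmetric[OF assms(1)] by (rule pre_digraph.reachable_mono)
  then show "v \<in> component_of G u" by (simp add: component_of_def)
qed

lemma subgraph_induce_subgraph_mono:
  assumes "subgraph H G" "verts H \<subseteq> V"
  shows "subgraph H (G \<restriction> V)"
  using assms
  by (auto simp: subgraph_def compatible_def wf_digraph.wellformed subset_iff)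

text \<open>A connected subgraph lies inside the component of any of its vertices, hence inside the
  subgraph induced there. That one is itself connected, so maximality forces equality.\<close>

lemma max_subgraph_connected_eq:
  "{H. max_subgraph Digraph_Component.connected H}
    = (\<lambda>C. G \<restriction> C) ` component_of G ` verts G"
proof (intro equalityI subsetI)
  fix H assume "H \<in> {H. max_subgraph Digraph_Component.connected H}"
  then have H: "subgraph H G" "Digraph_Component.connected H"
    and max: "\<And>H'. subgraph H H' \<Longrightarrow> subgraph H' G \<Longrightarrow> Digraph_Component.connected H' \<Longrightarrow> H' = H"
    by (auto simp: max_subgraph_def)
  obtain u where u: "u \<in> verts H"
    using H(2) by (auto simp: connected_def strongly_connected_def)
  then have uG: "u \<in> verts G" using H(1) by auto
  have "subgraph H (G \<restriction> component_of G u)"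
    by (intro subgraph_induce_subgraph_mono connected_subgraph_verts_subset H u)
  then have "G \<restriction> component_of G u = H"
    by (intro max subgraph_induce_subgraphI component_of_subset connected_induce_component_of uG)
  then show "H \<in> (\<lambda>C. G \<restriction> C) ` component_of G ` verts G"
    using uG by blast
next
  fix H assume "H \<in> (\<lambda>C. G \<restriction> C) ` component_of G ` verts G"
  then obtain u where u: "u \<in> verts G" and H: "H = G \<restriction> component_of G u" by blast
  have "max_subgraph Digraph_Component.connected H"
  proof (rule max_subgraphI)
    show "Digraph_Component.connected H"
      unfolding H by (rule connected_induce_component_of[OF u])
    show "subgraph H G"
      unfolding H by (intro subgraph_induce_subgraphI component_of_subset)
  next
    fix K assume K: "H \<noteq> K" "subgraph H K" "subgraph K G"
    show "\<not> Digraph_Component.connected K"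
    proof
      assume "Digraph_Component.connected K"
      moreover have "u \<in> verts K"
        using subgraph_imp_subverts[OF K(2)] component_of_refl[OF u] by (auto simp: H)
      ultimately have "verts K \<subseteq> component_of G u"
        using K(3) by (intro connected_subgraph_verts_subset)
      with K(3) have "subgraph K H"
        unfolding H by (rule subgraph_induce_subgraph_mono)
      with K(2) have "H = K"
        \<comment> \<open>Mutual inclusion settles vertices and arcs; the tail and head maps agree
          because \<open>subgraph\<close> includes compatibility.\<close>
        by (intro pre_digraph.equality) (auto simp: subgraph_def compatible_def)
      with K(1) show False by simp
    qed
  qed
  then show "H \<in> {H. max_subgraph Digraph_Component.connected H}" by simp
qed

lemma card_max_subgraph_connected:
  "card {H. max_subgraph Digraph_Component.connected H} = card (component_of G ` verts G)"
proof -
  have "inj_on (\<lambda>C. G \<restriction> C) (component_of G ` verts G)"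
    by (rule inj_on_inverseI[where g = verts]) simp
  then show ?thesis
    unfolding max_subgraph_connected_eq by (rule card_image)
qed

lemma constant_on_component_of:
  assumes "\<And>e. e \<in> arcs G \<Longrightarrow> f (tail G e) = f (head G e)" and "v \<in> component_of G u"
  shows "f v = f u"
proof -
  have "u \<rightarrow>\<^sup>*\<^bsub>mk_symmetric G\<^esub> v"
    using assms(2) by (simp add: component_of_def)
  then show ?thesis
    by (induction rule: S.reachable_induct) (auto simp: parcs_mk_symmetric assms(1))
qed

end

lemma card_connected_components:
  assumes "pair_digraph Q"
  shows "card (connected_components Q) = card (component_of (with_proj Q) ` pverts Q)"
proof -
  interpret pair_digraph Q by fact
  show ?thesis
    unfolding connected_components_def using card_max_subgraph_connected by simp
qed

section \<open>The span of the edge vectors\<close>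

lemma inner_vertex_indicator:
  "vertex_indicator A \<bullet> vertex_indicator B = real (card (A \<inter> B))"
  by (simp add: vertex_indicator_def inner_vec_def indicator_def Int_def flip: of_bool_conj)

lemma inner_edge_vector: "x \<bullet> edge_vector e = x $ fst e - x $ snd e"
  by (simp add: edge_vector_def vertex_indicator_def inner_vec_def right_diff_distrib
      sum_subtractf indicator_def if_distrib cong: if_cong)

lemma dim_supported_vectors:
  "dim {x :: real ^ 'v::finite. \<forall>i. i \<notin> V \<longrightarrow> x $ i = 0} = card V"
proof -
  let ?d = "(\<lambda>i. axis i (1::real)) ` V"
  have "{x :: real ^ 'v. \<forall>i. i \<notin> V \<longrightarrow> x $ i = 0} = {x. \<forall>i\<in>Basis. i \<notin> ?d \<longrightarrow> x \<bullet> i = 0}"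
    by (auto simp: Basis_vec_def inner_axis axis_eq_axis image_iff)
  moreover have "card ?d = card V"
    by (intro card_image inj_onI) (simp add: axis_eq_axis)
  moreover have "?d \<subseteq> Basis" by (auto simp: Basis_vec_def)
  ultimately show ?thesis by (simp add: dim_substandard)
qed

text \<open>The additive form avoids truncated subtraction on the naturals.\<close>

lemma dim_edge_vectors:
  fixes Q :: "'v::finite pair_pre_digraph"
  assumes "pair_digraph Q"
  shows "dim (edge_vector ` parcs Q) + card (connected_components Q) = card (pverts Q)"
proof -
  interpret pair_digraph Q by fact
  define W where "W = {x :: real ^ 'v. \<forall>i. i \<notin> pverts Q \<longrightarrow> x $ i = 0}"
  define E where "E = edge_vector ` parcs Q"
  define K where "K = component_of (with_proj Q) ` pverts Q"
  \<comment> \<open>The complement is taken inside \<open>W\<close>, since the type may contain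
    elements that are not vertices of \<open>Q\<close>.\<close>
  define O' where "O' = {y \<in> W. \<forall>x \<in> span E. orthogonal x y}"
  have W: "subspace W" unfolding W_def subspace_def by simp
  have "E \<subseteq> W"
    by (auto simp: E_def W_def edge_vector_def vertex_indicator_def indicator_def
        dest: wellformed')
  then have EW: "span E \<subseteq> W" using W by (rule span_minimal)
  have O'_iff: "y \<in> O' \<longleftrightarrow> y \<in> W \<and> (\<forall>e \<in> parcs Q. y $ fst e = y $ snd e)" for y
  proof -
    have "(\<forall>x \<in> span E. orthogonal x y) \<longleftrightarrow> (\<forall>x \<in> E. orthogonal y x)"
      by (meson orthogonal_commute orthogonal_to_span span_base)
    then show ?thesis
      unfolding O'_def by (auto simp: E_def orthogonal_def inner_edge_vector)
  qed
  have K_sub: "C \<subseteq> pverts Q" and K_ne: "C \<noteq> {}" if "C \<in> K" for C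
    using that component_of_subset component_of_refl by (auto simp: K_def)
  have disj: "A \<inter> B = {}" if "A \<in> K" "B \<in> K" "A \<noteq> B" for A B
    using that disjoint_component_of unfolding K_def by simp
  \<comment> \<open>The indicators of the components form a basis of \<open>O'\<close>: disjointness
    makes them orthogonal, nonemptiness makes them nonzero.\<close>
  have "dim O' = card (vertex_indicator ` K)"
  proof (rule dim_unique)
    show "vertex_indicator ` K \<subseteq> O'"
    proof (rule image_subsetI)
      fix C assume C: "C \<in> K"
      have "fst e \<in> C \<longleftrightarrow> snd e \<in> C" if e: "e \<in> parcs Q" for e
      proof -
        have "component_of (with_proj Q) (snd e) = component_of (with_proj Q) (fst e)"
          using component_of_arc[of e] e by simp
        moreover have "v \<in> C \<longleftrightarrow> component_of (with_proj Q) v = C" if "v \<in> pverts Q" for v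
          using C that component_of_eq component_of_refl by (auto simp: K_def)
        ultimately show ?thesis
          using e by simp
      qed
      then show "vertex_indicator C \<in> O'"
        using K_sub[OF C] by (auto simp: O'_iff W_def vertex_indicator_def indicator_def)
    qed
    show "independent (vertex_indicator ` K :: (real ^ 'v) set)"
    proof (rule pairwise_orthogonal_independent)
      show "pairwise orthogonal (vertex_indicator ` K :: (real ^ 'v) set)"
        using disj by (auto simp: pairwise_def orthogonal_def inner_vertex_indicator)
      have "vertex_indicator C \<noteq> (0 :: real ^ 'v)" if "C \<in> K" for C
        using K_ne[OF that] by (auto simp: vertex_indicator_def vec_eq_iff indicator_def)
      then show "(0 :: real ^ 'v) \<notin> vertex_indicator ` K" by force
    qed
    show "O' \<subseteq> span (vertex_indicator ` K)"
    proof
      fix y assume y: "y \<in> O'"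
      have const: "y $ v = y $ u" if "v \<in> component_of (with_proj Q) u" for u v
        by (rule constant_on_component_of[where f = "\<lambda>i. y $ i", OF _ that])
           (use y in \<open>simp add: O'_iff\<close>)
      \<comment> \<open>Since \<open>y\<close> is constant on each component, its value at any
        chosen representative serves as the coefficient.\<close>
      have "y = (\<Sum>C\<in>K. y $ (SOME u. u \<in> C) *\<^sub>R vertex_indicator C)"
      proof (unfold vec_eq_iff, rule allI)
        fix v
        show "y $ v = (\<Sum>C\<in>K. y $ (SOME u. u \<in> C) *\<^sub>R vertex_indicator C) $ v"
        proof (cases "v \<in> pverts Q")
          case True
          let ?C = "component_of (with_proj Q) v"
          have C: "?C \<in> K" "v \<in> ?C" using True component_of_refl by (auto simp: K_def)
          \<comment> \<open>By disjointness, \<open>?C\<close> is the only component containing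
            \<open>v\<close>, so a single summand survives.\<close>
          have "(\<Sum>C\<in>K. y $ (SOME u. u \<in> C) *\<^sub>R vertex_indicator C) $ v
              = (\<Sum>C\<in>K. if C = ?C then y $ (SOME u. u \<in> ?C) else 0)"
            unfolding sum_component using C disj
            by (intro sum.cong) (auto simp: vertex_indicator_def indicator_def)
          also have "\<dots> = y $ (SOME u. u \<in> ?C)"
            using C by (simp add: K_def)
          also have "\<dots> = y $ v"
            using C(2) by (intro const) (rule someI)
          finally show ?thesis by (rule sym)
        next
          case False
          then have "v \<notin> C" if "C \<in> K" for C
            using K_sub[OF that] by blast
          then have "(\<Sum>C\<in>K. y $ (SOME u. u \<in> C) *\<^sub>R vertex_indicator C) $ v = 0"
            unfolding sum_component by (intro sum.neutral) (simp add: vertex_indicator_def)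
          with False y show ?thesis by (simp add: O'_iff W_def)
        qed
      qed
      also have "\<dots> \<in> span (vertex_indicator ` K)"
        by (intro span_sum span_scale span_base imageI)
      finally show "y \<in> span (vertex_indicator ` K)" .
    qed
  qed simp
  \<comment> \<open>A set is determined by its indicator, so counting basis vectors counts
    components.\<close>
  also have "card (vertex_indicator ` K :: (real ^ 'v) set) = card K"
    by (intro card_image inj_onI)
       (auto simp: vertex_indicator_def vec_eq_iff indicator_def of_bool_eq_iff)
  finally have "dim O' = card (connected_components Q)"
    by (simp add: K_def card_connected_components[OF assms])
  moreover have "dim O' + dim (span E) = dim W"
    unfolding O'_def using W EW by (intro dim_subspace_orthogonal_to_vectors subspace_span)
  moreover have "dim W = card (pverts Q)"
    unfolding W_def by (rule dim_supported_vectors)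
  ultimately show ?thesis
    by (simp add: E_def)
qed

section \<open>The affine hull of the edge vectors\<close>

text \<open>If 0 is off the affine hull, the part of a point of \<open>S\<close> orthogonal to the
  directions of the hull is nonzero and has constant inner product with \<open>S\<close>; rescaling
  makes the constant 1. Conversely, a hyperplane at value 1 is affine and misses 0.\<close>

lemma zero_notin_affine_hull_iff:
  fixes S :: "'a::euclidean_space set"
  shows "0 \<notin> affine hull S \<longleftrightarrow> (\<exists>a. \<forall>x \<in> S. a \<bullet> x = 1)"
proof
  assume 0: "0 \<notin> affine hull S"
  show "\<exists>a. \<forall>x \<in> S. a \<bullet> x = 1"
  proof (cases "S = {}")
    case False
    then obtain b where b: "b \<in> S" by blast
    \<comment> \<open>The span of \<open>?D\<close> is the direction space of the affine hull, and
      \<open>z\<close> below is the component of \<open>b\<close> normal to it.\<close>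
    let ?D = "(\<lambda>x. - b + x) ` S"
    obtain y z where y: "y \<in> span ?D" and z: "\<And>w. w \<in> span ?D \<Longrightarrow> orthogonal z w"
      and byz: "b = y + z"
      using orthogonal_subspace_decomp_exists[of ?D b] by metis
    have "z \<noteq> 0"
    proof
      assume "z = 0"
      then have "- b \<in> span ?D" using y byz span_neg by auto
      then have "b + - b \<in> affine hull S"
        unfolding affine_hull_span_gen[OF hull_inc[OF b]] by (rule imageI)
      with 0 show False by simp
    qed
    \<comment> \<open>Both \<open>x - b\<close> and \<open>y\<close> lie in the direction space, so
      \<open>x\<close> and \<open>b = y + z\<close> have the same inner product with
      \<open>z\<close> as \<open>z\<close> itself.\<close>
    have "z \<bullet> x = z \<bullet> z" if "x \<in> S" for x
    proof -
      have "- b + x \<in> span ?D" using that by (intro span_base imageI)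
      from z[OF this] z[OF y] show ?thesis
        by (simp add: byz orthogonal_def inner_add_right inner_diff_right)
    qed
    with \<open>z \<noteq> 0\<close> have "\<forall>x \<in> S. (z /\<^sub>R (z \<bullet> z)) \<bullet> x = 1" by simp
    then show ?thesis by blast
  qed simp
next
  assume "\<exists>a. \<forall>x \<in> S. a \<bullet> x = 1"
  then obtain a where "S \<subseteq> {x. a \<bullet> x = 1}" by blast
  then have "affine hull S \<subseteq> {x. a \<bullet> x = 1}"
    by (intro hull_minimal affine_hyperplane)
  then show "0 \<notin> affine hull S" by auto
qed

text \<open>Adjoining 0 turns affine dimension into linear dimension, and raises the former by one
  exactly when 0 is outside the affine hull. For empty \<open>S\<close> this gives -1, so quivers
  without edges need no separate case.\<close>

lemma aff_dim_eq_dim_if: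
  fixes S :: "'a::euclidean_space set"
  shows "aff_dim S = (if 0 \<in> affine hull S then int (dim S) else int (dim S) - 1)"
proof -
  have "aff_dim (insert 0 S) = int (dim S)"
    by (metis aff_dim_zero dim_span hull_inc insertI1 span_insert_0)
  then show ?thesis
    using aff_dim_insert[of 0 S] by (simp split: if_splits)
qed

text \<open>An edge vector is tail minus head while ranks increase from tail to head, hence the sign
  change between a rank function and a functional equal to 1 on all edge vectors.\<close>

lemma rank_function_iff_affine_hull:
  fixes Q :: "'v::finite pair_pre_digraph"
  shows "(\<exists>\<rho>. rank_function Q \<rho>) \<longleftrightarrow> 0 \<notin> affine hull (edge_vector ` parcs Q)"
proof -
  have "rank_function Q (\<lambda>v. - a $ v) \<longleftrightarrow> (\<forall>x \<in> edge_vector ` parcs Q. a \<bullet> x = 1)"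
    for a :: "real ^ 'v"
    by (fastforce simp: rank_function_def inner_edge_vector)
  \<comment> \<open>Every real function on the finite type arises from a vector in this way, so no
    rank function is missed.\<close>
  moreover have "\<rho> = (\<lambda>v. - (\<chi> u. - \<rho> u) $ v)" for \<rho> :: "'v \<Rightarrow> real"
    by simp
  ultimately show ?thesis
    unfolding zero_notin_affine_hull_iff by metis
qed

theorem theorem1p1:
  fixes Q :: "'v::finite pair_pre_digraph"
  assumes "pair_digraph Q"
  shows "aff_dim (directed_edge_polytope Q) =
    (if \<exists>\<rho>. rank_function Q \<rho>
     then int (card (pverts Q)) - int (card (connected_components Q)) - 1
     else int (card (pverts Q)) - int (card (connected_components Q)))"
proof -
  have "int (dim (edge_vector ` parcs Q)) =
      int (card (pverts Q)) - int (card (connected_components Q))"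
    using dim_edge_vectors[OF assms] by linarith
  then show ?thesis
    unfolding directed_edge_polytope_def aff_dim_convex_hull rank_function_iff_affine_hull
    by (simp add: aff_dim_eq_dim_if)
qed

end
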